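(* For all $n\ge1$ and $k,\ell,m,j\ge 0$, let $$h_n(k,\ell,m,j)=\bigl|\{\pi\in\mathcal{I}_n(321,4123) : \operatorname{fp}(\pi)=m,\ \operatorname{exc}(\pi)=\ell,\ \operatorname{cyc}(\pi)=k,\ \operatorname{inv}(\pi)=j\}\bigr|,$$ and let $$H(t,u,x,y,z)=\sum_{n\ge1}\ \sum_{k,\ell,m,j\ge 0} h_n(k,\ell,m,j)\,t^ku^mx^\ell y^jz^n,$$ a formal power series in $z$ with coefficients in $\mathbb{Z}[t,u,x,y]$. Then $$H(t,u,x,y,z)=\frac{tuz+txyz^2+t^2x^2y^4z^4}{1-tuz-txyz^2-t^2x^2y^4z^4}.$$
   Context: $\mathcal{S}_n$ is the set of permutations of $[n]=\{1,\dots,n\}$; $\pi\in\mathcal{S}_n$ is written in one-line notation as $\pi=\pi_1\pi_2\cdots\pi_n$ with $\pi_i=\pi(i)$. A permutation $\pi\in\mathcal{S}_n$ contains a pattern $\sigma\in\mathcal{S}_r$ if there are indices $i_1<\dots<i_r$ such that $\pi_{i_1}\cdots\pi_{i_r}$ is in the same relative order as $\sigma$; otherwise $\pi$ avoids $\sigma$. $\mathcal{I}_n(321,4123)$ is the set of involutions $\pi\in\mathcal{S}_n$ (i.e. $\pi^{-1}=\pi$, the identity included) avoiding both patterns $321$ and $4123$. $\operatorname{cyc}(\pi)$ is the number of cycles in the disjoint cycle decomposition of $\pi$ (fixed points counted as cycles); $\operatorname{fp}(\pi)$ is the number of $i$ with $\pi_i=i$; $\operatorname{exc}(\pi)$ is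 the number of $j$ with $\pi_j>j$; $\operatorname{inv}(\pi)$ is the number of pairs $i<j$ with $\pi_i>\pi_j$. *)

theory Defs
  imports
    "HOL-Combinatorics.Orbits"
    "HOL-Computational_Algebra.Formal_Power_Series"
    "HOL-Computational_Algebra.Polynomial_Factorial"
    "HOL-Library.Groups_Big_Fun"
begin

text \<open>Patterns are given in one-line notation, as lists. The list \<open>is\<close> holds the indices
  \<open>i_1 < ... < i_r\<close> of the occurrence.\<close>

definition contains_pattern :: "nat \<Rightarrow> (nat \<Rightarrow> nat) \<Rightarrow> nat list \<Rightarrow> bool" where
  "contains_pattern n \<pi> \<sigma> \<longleftrightarrow>
     (\<exists>is. length is = length \<sigma> \<and> sorted_wrt (<) is \<and> set is \<subseteq> {1..n} \<and>
        (\<forall>a<length \<sigma>. \<forall>b<length \<sigma>. \<pi> (is ! a) < \<pi> (is ! b) \<longleftrightarrow> \<sigma> ! a < \<sigma> ! b))"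

definition avoiding_involutions :: "nat \<Rightarrow> nat list set \<Rightarrow> (nat \<Rightarrow> nat) set" where
  "avoiding_involutions n \<Sigma> =
     {\<pi>. \<pi> permutes {1..n} \<and> inv \<pi> = \<pi> \<and> (\<forall>\<sigma>\<in>\<Sigma>. \<not> contains_pattern n \<pi> \<sigma>)}"

text \<open>The cycles of a permutation of \<open>{1..n}\<close> are identified with their supports, the orbits;
  a fixed point \<open>i\<close> contributes the orbit \<open>{i}\<close>.\<close>

definition cyc :: "nat \<Rightarrow> (nat \<Rightarrow> nat) \<Rightarrow> nat" where
  "cyc n \<pi> = card (orbit \<pi> ` {1..n})"

definition fp :: "nat \<Rightarrow> (nat \<Rightarrow> nat) \<Rightarrow> nat" where
  "fp n \<pi> = card {i \<in> {1..n}. \<pi> i = i}"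

definition exc :: "nat \<Rightarrow> (nat \<Rightarrow> nat) \<Rightarrow> nat" where
  "exc n \<pi> = card {i \<in> {1..n}. \<pi> i > i}"

definition inversions :: "nat \<Rightarrow> (nat \<Rightarrow> nat) \<Rightarrow> nat" where
  "inversions n \<pi> = card {(i, j). i \<in> {1..n} \<and> j \<in> {1..n} \<and> i < j \<and> \<pi> i > \<pi> j}"

definition h :: "nat \<Rightarrow> nat \<Rightarrow> nat \<Rightarrow> nat \<Rightarrow> nat \<Rightarrow> nat" where
  "h n k l m j =
     card {\<pi> \<in> avoiding_involutions n {[3,2,1], [4,1,2,3]}.
             fp n \<pi> = m \<and> exc n \<pi> = l \<and> cyc n \<pi> = k \<and> inversions n \<pi> = j}"

text \<open>The polynomial ring \<open>\<int>[t,u,x,y]\<close> is represented as \<open>\<int>[t][u][x][y]\<close>.\<close>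

type_synonym tuxy_poly = "int poly poly poly poly"

definition var_t :: tuxy_poly where "var_t = [:[:[:[:0, 1:]:]:]:]"
definition var_u :: tuxy_poly where "var_u = [:[:[:0, 1:]:]:]"
definition var_x :: tuxy_poly where "var_x = [:[:0, 1:]:]"
definition var_y :: tuxy_poly where "var_y = [:0, 1:]"

lemma cyc_le: "cyc n \<pi> \<le> n"
  unfolding cyc_def using card_image_le[of "{1..n}" "orbit \<pi>"] by simp

lemma fp_le: "fp n \<pi> \<le> n"
proof -
  have "fp n \<pi> \<le> card {1..n}"
    unfolding fp_def by (rule card_mono) auto
  then show ?thesis by simp
qed

lemma exc_le: "exc n \<pi> \<le> n"
proof -
  have "exc n \<pi> \<le> card {1..n}"
    unfolding exc_def by (rule card_mono) auto
  then show ?thesis by simp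
qed

lemma inversions_le: "inversions n \<pi> \<le> n * n"
proof -
  have "inversions n \<pi> \<le> card ({1..n} \<times> {1..n})"
    unfolding inversions_def by (rule card_mono) auto
  then show ?thesis by simp
qed

text \<open>\<open>Sum_any\<close> is \<open>0\<close> for a summand of infinite support; the following lemma shows that this
  case does not arise in the definition of \<open>H\<close>.\<close>

lemma finite_support_h: "finite {(k, l, m, j). h n k l m j \<noteq> 0}"
proof (rule finite_subset)
  have "k \<le> n \<and> l \<le> n \<and> m \<le> n \<and> j \<le> n * n" if "h n k l m j \<noteq> 0" for k l m j
  proof -
    have "{\<pi> \<in> avoiding_involutions n {[3,2,1], [4,1,2,3]}.
             fp n \<pi> = m \<and> exc n \<pi> = l \<and> cyc n \<pi> = k \<and> inversions n \<pi> = j} \<noteq> {}"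
      using that unfolding h_def by (rule contrapos_nn) (simp only: card.empty)
    then obtain \<pi> where "fp n \<pi> = m" "exc n \<pi> = l" "cyc n \<pi> = k" "inversions n \<pi> = j"
      by blast
    then show ?thesis
      using cyc_le[of n \<pi>] fp_le[of n \<pi>] exc_le[of n \<pi>] inversions_le[of n \<pi>] by simp
  qed
  then show "{(k, l, m, j). h n k l m j \<noteq> 0} \<subseteq> {..n} \<times> {..n} \<times> {..n} \<times> {..n * n}"
    by blast
qed simp

definition H :: "tuxy_poly fps" where
  "H = Abs_fps (\<lambda>n. if n \<ge> 1
         then Sum_any (\<lambda>(k, l, m, j).
                of_nat (h n k l m j) * var_t ^ k * var_u ^ m * var_x ^ l * var_y ^ j)
         else 0)"

end

theory Submission
  imports Defs
begin

text \<open>If \<open>\<pi>\<close> is an involution avoiding \<open>321\<close> and \<open>4123\<close>, then the entries smaller than \<open>\<pi> i\<close> to the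
  right of \<open>i\<close> increase, and as \<open>\<pi>\<close> is an involution their positions are again values of \<open>\<pi>\<close>. Hence
  \<open>\<pi> 1 \<ge> 4\<close> would make \<open>\<pi> 1, 1, 2, 3\<close> an occurrence of \<open>4123\<close>, and \<open>\<pi> 1 = 3\<close> with \<open>\<pi> 2 > 4\<close>
  would make \<open>\<pi> 2, 1, 2, 4\<close> one. So \<open>\<pi>\<close> begins with a block \<open>1\<close>, \<open>21\<close> or \<open>3412\<close>. Both patterns are
  sum indecomposable, so what follows the block is an arbitrary avoiding involution, and
  the three blocks give the three terms of the denominator.\<close>

section \<open>Direct sums of permutations\<close>

text \<open>Only the size of the first summand is a parameter: a permutation of
  \<open>{1..n}\<close> is the identity above \<open>n\<close>, so its shift is the identity above
  \<open>b + n\<close>. Index \<open>0\<close> falls under the first branch, where a permutation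
  \<open>\<tau>\<close> of \<open>{1..b}\<close> fixes it.\<close>

definition dsum :: "nat \<Rightarrow> (nat \<Rightarrow> nat) \<Rightarrow> (nat \<Rightarrow> nat) \<Rightarrow> nat \<Rightarrow> nat" where
  "dsum b \<tau> \<pi> i = (if i \<le> b then \<tau> i else \<pi> (i - b) + b)"

lemma dsum_low [simp]: "i \<le> b \<Longrightarrow> dsum b \<tau> \<pi> i = \<tau> i"
  by (simp add: dsum_def)

lemma dsum_high [simp]: "1 \<le> i \<Longrightarrow> dsum b \<tau> \<pi> (i + b) = \<pi> i + b"
  by (simp add: dsum_def)

lemma permutes_atLeast1_le: "\<lbrakk>\<pi> permutes {1..n}; i \<le> n\<rbrakk> \<Longrightarrow> \<pi> i \<le> (n::nat)"
  by (metis atLeastAtMost_iff not_less_eq_eq permutes_in_image permutes_not_in zero_le One_nat_def)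

lemma permutes_atLeast1_ge: "\<lbrakk>\<pi> permutes {1..n}; 1 \<le> i\<rbrakk> \<Longrightarrow> 1 \<le> (\<pi> i :: nat)"
  by (metis atLeastAtMost_iff permutes_in_image permutes_not_in)

lemma permutes_inv_eq_iff:
  assumes "\<pi> permutes S"
  shows "inv \<pi> = \<pi> \<longleftrightarrow> (\<forall>i. \<pi> (\<pi> i) = i)"
  using assms by (metis permutes_inv_eq permutes_inverses(1) ext)

text \<open>The unique preimage of a point under \<open>\<pi>\<close> is its image under
  \<open>\<pi>\<close>.\<close>

lemma involution_permutes:
  assumes "\<And>i. \<pi> (\<pi> i) = i" and "\<And>i. i \<notin> S \<Longrightarrow> \<pi> i = i"
  shows "\<pi> permutes S"
  unfolding permutes_def using assms by metis

lemma avoiding_involutions_iff: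
  "\<pi> \<in> avoiding_involutions n \<Sigma> \<longleftrightarrow>
     \<pi> permutes {1..n} \<and> (\<forall>i. \<pi> (\<pi> i) = i) \<and> (\<forall>\<sigma>\<in>\<Sigma>. \<not> contains_pattern n \<pi> \<sigma>)"
  unfolding avoiding_involutions_def using permutes_inv_eq_iff by auto

lemma dsum_involution:
  assumes "\<tau> permutes {1..b}" "\<pi> permutes {1..n}" "\<forall>i. \<tau> (\<tau> i) = i" "\<forall>i. \<pi> (\<pi> i) = i"
  shows "dsum b \<tau> \<pi> (dsum b \<tau> \<pi> i) = i"
proof (cases "i \<le> b")
  case True
  then show ?thesis
    using assms permutes_atLeast1_le[OF assms(1) True] by simp
next
  case False
  then obtain k where k: "i = k + b" "1 \<le> k"
    by (metis add.commute le_add_diff_inverse less_eq_Suc_le nle_le not_le zero_less_diff One_nat_def)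
  then show ?thesis
    using assms permutes_atLeast1_ge[OF assms(2) k(2)] by simp
qed

lemma dsum_permutes:
  assumes "\<tau> permutes {1..b}" "\<pi> permutes {1..n}" "\<forall>i. \<tau> (\<tau> i) = i" "\<forall>i. \<pi> (\<pi> i) = i"
  shows "dsum b \<tau> \<pi> permutes {1..b + n}"
proof (rule involution_permutes)
  show "dsum b \<tau> \<pi> (dsum b \<tau> \<pi> i) = i" for i
    using dsum_involution[OF assms] .
  show "dsum b \<tau> \<pi> i = i" if "i \<notin> {1..b + n}" for i
  proof (cases "i \<le> b")
    case True
    then have "i \<notin> {1..b}" using that by auto
    then show ?thesis using True permutes_not_in[OF assms(1)] by simp
  next
    case False
    then have "i - b \<notin> {1..n}" using that by auto
    then show ?thesis using False permutes_not_in[OF assms(2)] by (simp add: dsum_def)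
  qed
qed

text \<open>A pattern that begins with its maximum cannot straddle the two summands.\<close>

lemma contains_pattern_dsum:
  assumes \<tau>: "\<tau> permutes {1..b}" and \<pi>: "\<pi> permutes {1..n}"
    and \<sigma>: "\<sigma> \<noteq> []" "\<And>a. 0 < a \<Longrightarrow> a < length \<sigma> \<Longrightarrow> \<sigma> ! a < \<sigma> ! 0"
  shows "contains_pattern (b + n) (dsum b \<tau> \<pi>) \<sigma> \<longleftrightarrow>
           contains_pattern b \<tau> \<sigma> \<or> contains_pattern n \<pi> \<sigma>"
proof (intro iffI; (elim disjE)?)
  assume "contains_pattern (b + n) (dsum b \<tau> \<pi>) \<sigma>"
  then obtain js where len: "length js = length \<sigma>" and srt: "sorted_wrt (<) js"
    and sub: "set js \<subseteq> {1..b + n}"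
    and ord: "\<And>a c. a < length \<sigma> \<Longrightarrow> c < length \<sigma> \<Longrightarrow>
      dsum b \<tau> \<pi> (js ! a) < dsum b \<tau> \<pi> (js ! c) \<longleftrightarrow> \<sigma> ! a < \<sigma> ! c"
    unfolding contains_pattern_def by blast
  have rng: "1 \<le> js ! a \<and> js ! a \<le> b + n" if "a < length \<sigma>" for a
    using sub that len by (metis atLeastAtMost_iff nth_mem subsetD)
  have inc: "js ! 0 \<le> js ! a" if "a < length \<sigma>" for a
    using srt that len by (cases a) (auto simp: sorted_wrt_iff_nth_less intro: less_imp_le)
  show "contains_pattern b \<tau> \<sigma> \<or> contains_pattern n \<pi> \<sigma>"
  proof (cases "js ! 0 \<le> b")
    case True
    \<comment> \<open>The first entry of the occurrence is its maximum and is at most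
      \<open>b\<close>, so every other entry is below \<open>b\<close>; values at positions beyond
      \<open>b\<close> are at least \<open>b\<close>.\<close>
    have low: "js ! a \<le> b" if a: "a < length \<sigma>" for a
    proof (cases "a = 0")
      case False
      then have "dsum b \<tau> \<pi> (js ! a) < dsum b \<tau> \<pi> (js ! 0)"
        using ord[OF a, of 0] \<sigma> a by simp
      also have "\<dots> \<le> b" using True permutes_atLeast1_le[OF \<tau>] by simp
      finally show ?thesis unfolding dsum_def by (auto split: if_splits)
    qed (use True in simp)
    then have "set js \<subseteq> {1..b}" using rng len by (auto simp: in_set_conv_nth)
    moreover have "\<tau> (js ! a) < \<tau> (js ! c) \<longleftrightarrow> \<sigma> ! a < \<sigma> ! c"
      if "a < length \<sigma>" "c < length \<sigma>" for a c
      using ord[OF that] low that by simp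
    ultimately show ?thesis using len srt unfolding contains_pattern_def by blast
  next
    case False
    \<comment> \<open>The first position is the smallest, so the whole occurrence lies in the second
      summand and can be shifted down by \<open>b\<close>.\<close>
    then have high: "b < js ! a" if "a < length \<sigma>" for a
      using inc[OF that] by simp
    let ?ks = "map (\<lambda>i. i - b) js"
    have "sorted_wrt (<) ?ks"
      using srt high len unfolding sorted_wrt_iff_nth_less
      by (simp add: diff_less_mono less_imp_le)
    moreover have "set ?ks \<subseteq> {1..n}"
    proof
      fix j assume "j \<in> set ?ks"
      then obtain a where "a < length \<sigma>" "j = js ! a - b"
        using len by (auto simp: in_set_conv_nth)
      then show "j \<in> {1..n}" using high[of a] rng[of a] by auto
    qed
    moreover have "\<pi> (?ks ! a) < \<pi> (?ks ! c) \<longleftrightarrow> \<sigma> ! a < \<sigma> ! c"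
      if "a < length \<sigma>" "c < length \<sigma>" for a c
      using ord[OF that] high[OF that(1)] high[OF that(2)] len that by (simp add: dsum_def)
    ultimately show ?thesis using len unfolding contains_pattern_def
      by (metis length_map)
  qed
next
  assume "contains_pattern b \<tau> \<sigma>"
  then obtain js where "length js = length \<sigma>" "sorted_wrt (<) js"
    and sub: "set js \<subseteq> {1..b}"
    and "\<forall>a<length \<sigma>. \<forall>c<length \<sigma>. \<tau> (js ! a) < \<tau> (js ! c) \<longleftrightarrow> \<sigma> ! a < \<sigma> ! c"
    unfolding contains_pattern_def by blast
  moreover have "js ! a \<le> b" if "a < length js" for a
    using sub that by (metis atLeastAtMost_iff nth_mem subsetD)
  ultimately show "contains_pattern (b + n) (dsum b \<tau> \<pi>) \<sigma>"
    unfolding contains_pattern_def by (intro exI[of _ js]) auto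
next
  assume "contains_pattern n \<pi> \<sigma>"
  then obtain js where len: "length js = length \<sigma>" and "sorted_wrt (<) js"
    and sub: "set js \<subseteq> {1..n}"
    and "\<forall>a<length \<sigma>. \<forall>c<length \<sigma>. \<pi> (js ! a) < \<pi> (js ! c) \<longleftrightarrow> \<sigma> ! a < \<sigma> ! c"
    unfolding contains_pattern_def by blast
  moreover have "1 \<le> js ! a" if "a < length js" for a
    using sub that by (metis atLeastAtMost_iff nth_mem subsetD)
  ultimately show "contains_pattern (b + n) (dsum b \<tau> \<pi>) \<sigma>"
    unfolding contains_pattern_def
    by (intro exI[of _ "map (\<lambda>i. i + b) js"]) (auto simp: sorted_wrt_map)
qed

lemma dsum_in_avoiding_involutions:
  assumes "\<tau> \<in> avoiding_involutions b \<Sigma>" "\<pi> \<in> avoiding_involutions n \<Sigma>"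
    and "\<And>\<sigma>. \<sigma> \<in> \<Sigma> \<Longrightarrow> \<sigma> \<noteq> [] \<and> (\<forall>a<length \<sigma>. 0 < a \<longrightarrow> \<sigma> ! a < \<sigma> ! 0)"
  shows "dsum b \<tau> \<pi> \<in> avoiding_involutions (b + n) \<Sigma>"
  using assms dsum_permutes[of \<tau> b \<pi> n] dsum_involution[of \<tau> b \<pi> n]
    contains_pattern_dsum[of \<tau> b \<pi> n]
  unfolding avoiding_involutions_iff by auto

text \<open>Converse of \<open>dsum_in_avoiding_involutions\<close>: once \<open>\<rho>\<close> maps
  \<open>{1..b}\<close> to itself it also maps the positions above \<open>b\<close> to themselves,
  and its restriction there, shifted down, is the second summand.\<close>

lemma avoiding_involution_split:
  assumes \<rho>: "\<rho> \<in> avoiding_involutions (b + n) \<Sigma>" and \<tau>: "\<tau> permutes {1..b}"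
    and agree: "\<forall>i\<in>{1..b}. \<rho> i = \<tau> i"
    and \<Sigma>: "\<And>\<sigma>. \<sigma> \<in> \<Sigma> \<Longrightarrow> \<sigma> \<noteq> [] \<and> (\<forall>a<length \<sigma>. 0 < a \<longrightarrow> \<sigma> ! a < \<sigma> ! 0)"
  obtains \<pi> where "\<pi> \<in> avoiding_involutions n \<Sigma>" "\<rho> = dsum b \<tau> \<pi>"
proof
  have perm: "\<rho> permutes {1..b + n}" and invol: "\<rho> (\<rho> i) = i" for i
    using \<rho> by (auto simp: avoiding_involutions_iff)
  define \<pi> where "\<pi> i = (if i = 0 then 0 else \<rho> (i + b) - b)" for i
  have low: "\<rho> i = \<tau> i" if "i \<le> b" for i
    using that agree permutes_not_in[OF \<tau>, of 0] permutes_not_in[OF perm, of 0]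
    by (cases "i = 0") auto
  \<comment> \<open>If \<open>\<rho> i\<close> were at most \<open>b\<close>, then \<open>i\<close>,
    being \<open>\<rho> (\<rho> i)\<close>, would be \<open>\<tau> (\<rho> i)\<close> and hence at
    most \<open>b\<close>. This also makes the truncated subtraction in \<open>\<pi>\<close> exact
    for positive arguments.\<close>
  have high: "b < \<rho> i" if "b < i" for i
    using that invol low permutes_atLeast1_le[OF \<tau>] by (metis not_le)
  have inv\<pi>: "\<pi> (\<pi> i) = i" for i
    using high[of "i + b"] invol[of "i + b"] by (auto simp: \<pi>_def)
  moreover have "\<pi> i = i" if "i \<notin> {1..n}" for i
    using that permutes_not_in[OF perm, of "i + b"] by (auto simp: \<pi>_def)
  ultimately have perm\<pi>: "\<pi> permutes {1..n}" by (rule involution_permutes)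
  show eq: "\<rho> = dsum b \<tau> \<pi>"
  proof
    fix i show "\<rho> i = dsum b \<tau> \<pi> i"
      using low[of i] high[of i] by (auto simp: dsum_def \<pi>_def)
  qed
  show "\<pi> \<in> avoiding_involutions n \<Sigma>"
    using \<rho> inv\<pi> perm\<pi> contains_pattern_dsum[OF \<tau> perm\<pi>] \<Sigma>
    unfolding avoiding_involutions_iff eq by auto
qed

text \<open>For positive \<open>i\<close> the value \<open>\<pi> i\<close> is read off at position
  \<open>i + b\<close>. The value at \<open>0\<close> leaves no trace in the sum, but permutations
  of \<open>{1..n}\<close> all fix \<open>0\<close>.\<close>

lemma inj_on_dsum: "inj_on (dsum b \<tau>) {\<pi>. \<pi> permutes {1..n}}"
proof (rule inj_onI, rule ext)
  fix \<pi> \<pi>' i assume *: "\<pi> \<in> {\<pi>. \<pi> permutes {1..n}}" "\<pi>' \<in> {\<pi>. \<pi> permutes {1..n}}"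
    and eq: "dsum b \<tau> \<pi> = dsum b \<tau> \<pi>'"
  show "\<pi> i = \<pi>' i"
  proof (cases "i = 0")
    case True
    then show ?thesis
      using * permutes_not_in[of \<pi> "{1..n}" 0] permutes_not_in[of \<pi>' "{1..n}" 0] by simp
  next
    case False
    then show ?thesis using fun_cong[OF eq, of "i + b"] by simp
  qed
qed

section \<open>Statistics of direct sums\<close>

lemma atLeastAtMost_add_split: "{1..b + n} = {1..b} \<union> (\<lambda>i. i + b) ` {1..n::nat}"
  by (auto simp: image_iff intro: bexI[of _ "_ - b"])

lemma card_filter_add_split:
  "card {i \<in> {1..b + n}. P i} = card {i \<in> {1..b}. P i} + card {i \<in> {1..n::nat}. P (i + b)}"
proof -
  have "{i \<in> {1..b + n}. P i} = {i \<in> {1..b}. P i} \<union> (\<lambda>i. i + b) ` {i \<in> {1..n}. P (i + b)}"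
    unfolding atLeastAtMost_add_split by blast
  then show ?thesis
    by (simp only:) (subst card_Un_disjoint, auto simp: card_image)
qed

lemma fp_dsum: "fp (b + n) (dsum b \<tau> \<pi>) = fp b \<tau> + fp n \<pi>"
  unfolding fp_def card_filter_add_split
  by (intro arg_cong2[where f = "(+)"] arg_cong[where f = card]) auto

lemma exc_dsum: "exc (b + n) (dsum b \<tau> \<pi>) = exc b \<tau> + exc n \<pi>"
  unfolding exc_def card_filter_add_split
  by (intro arg_cong2[where f = "(+)"] arg_cong[where f = card]) auto

text \<open>No inversion straddles the summands: values at positions up to \<open>b\<close> are at
  most \<open>b\<close>, later ones at least \<open>b\<close>.\<close>

lemma inversions_dsum:
  assumes \<tau>: "\<tau> permutes {1..b}"
  shows "inversions (b + n) (dsum b \<tau> \<pi>) = inversions b \<tau> + inversions n \<pi>"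
proof -
  define I where "I n \<pi> = {(i, j). i \<in> {1..n} \<and> j \<in> {1..n} \<and> i < j \<and> \<pi> i > \<pi> j}"
    for n :: nat and \<pi> :: "nat \<Rightarrow> nat"
  have fin: "finite (I n \<pi>)" for n \<pi>
    by (rule finite_subset[of _ "{1..n} \<times> {1..n}"]) (auto simp: I_def)
  have "I (b + n) (dsum b \<tau> \<pi>) = I b \<tau> \<union> map_prod (\<lambda>i. i + b) (\<lambda>i. i + b) ` I n \<pi>"
  proof (intro equalityI subsetI)
    fix p assume "p \<in> I (b + n) (dsum b \<tau> \<pi>)"
    then obtain i j where p: "p = (i, j)" "1 \<le> i" "i < j" "j \<le> b + n"
      "dsum b \<tau> \<pi> j < dsum b \<tau> \<pi> i"
      by (auto simp: I_def)
    consider "j \<le> b" | "i \<le> b" "b < j" | "b < i" using p by linarith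
    then show "p \<in> I b \<tau> \<union> map_prod (\<lambda>i. i + b) (\<lambda>i. i + b) ` I n \<pi>"
    proof cases
      case 1
      then show ?thesis using p by (auto simp: I_def)
    next
      case 2
      then show ?thesis using p permutes_atLeast1_le[OF \<tau>, of i] by (simp add: dsum_def)
    next
      case 3
      then have "(i - b, j - b) \<in> I n \<pi>" using p by (auto simp: I_def dsum_def)
      moreover have "p = map_prod (\<lambda>i. i + b) (\<lambda>i. i + b) (i - b, j - b)" using 3 p by simp
      ultimately show ?thesis by blast
    qed
  qed (auto simp: I_def)
  moreover have "I b \<tau> \<inter> map_prod (\<lambda>i. i + b) (\<lambda>i. i + b) ` I n \<pi> = {}"
    by (auto simp: I_def)
  moreover have "card (map_prod (\<lambda>i. i + b) (\<lambda>i. i + b) ` I n \<pi>) = card (I n \<pi>)"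
    by (intro card_image inj_onI) auto
  ultimately have "card (I (b + n) (dsum b \<tau> \<pi>)) = card (I b \<tau>) + card (I n \<pi>)"
    by (simp add: card_Un_disjoint fin)
  then show ?thesis unfolding inversions_def I_def .
qed

lemma orbit_involution:
  assumes "\<forall>i. \<pi> (\<pi> i) = i"
  shows "orbit \<pi> i = {i, \<pi> i}"
proof
  show "orbit \<pi> i \<subseteq> {i, \<pi> i}"
  proof
    fix j assume "j \<in> orbit \<pi> i"
    then show "j \<in> {i, \<pi> i}" by induction (use assms in auto)
  qed
  show "{i, \<pi> i} \<subseteq> orbit \<pi> i"
    using assms orbit.intros(1)[of \<pi> i] orbit.intros(2)[of "\<pi> i" \<pi> i] by auto
qed

text \<open>Each orbit is some \<open>{i, \<pi> i}\<close> and is represented by its smaller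
  element, which is either a fixed point or an excedance. Additivity of \<open>cyc\<close> over
  direct sums thus reduces to that of \<open>fp\<close> and \<open>exc\<close>.\<close>

lemma cyc_involution:
  assumes perm: "\<pi> permutes {1..n}" and inv: "\<forall>i. \<pi> (\<pi> i) = i"
  shows "cyc n \<pi> = fp n \<pi> + exc n \<pi>"
proof -
  let ?M = "{i \<in> {1..n}. i \<le> \<pi> i}"
  have "orbit \<pi> ` {1..n} = orbit \<pi> ` ?M"
  proof (intro equalityI subsetI)
    fix S assume "S \<in> orbit \<pi> ` {1..n}"
    then obtain i where i: "i \<in> {1..n}" "S = {i, \<pi> i}" by (auto simp: orbit_involution[OF inv])
    show "S \<in> orbit \<pi> ` ?M"
    proof (cases "i \<le> \<pi> i")
      case True
      then show ?thesis using i by (auto simp: orbit_involution[OF inv])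
    next
      case False
      then have "\<pi> i \<in> ?M" using i permutes_in_image[OF perm, of i] inv by simp
      moreover have "S = orbit \<pi> (\<pi> i)" using i inv by (auto simp: orbit_involution[OF inv])
      ultimately show ?thesis by blast
    qed
  qed auto
  moreover have "inj_on (orbit \<pi>) ?M"
    by (rule inj_onI) (auto simp: orbit_involution[OF inv] doubleton_eq_iff)
  ultimately have "cyc n \<pi> = card ?M" by (simp add: cyc_def card_image)
  also have "?M = {i \<in> {1..n}. \<pi> i = i} \<union> {i \<in> {1..n}. i < \<pi> i}" by auto
  also have "card \<dots> = fp n \<pi> + exc n \<pi>"
    unfolding fp_def exc_def by (rule card_Un_disjoint) auto
  finally show ?thesis .
qed

definition weight :: "nat \<Rightarrow> (nat \<Rightarrow> nat) \<Rightarrow> tuxy_poly" where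
  "weight n \<pi> = var_t ^ cyc n \<pi> * var_u ^ fp n \<pi> * var_x ^ exc n \<pi> * var_y ^ inversions n \<pi>"

lemma weight_dsum:
  assumes "\<tau> \<in> avoiding_involutions b \<Sigma>" "\<pi> \<in> avoiding_involutions n \<Sigma>"
  shows "weight (b + n) (dsum b \<tau> \<pi>) = weight b \<tau> * weight n \<pi>"
proof -
  have *: "\<tau> permutes {1..b}" "\<pi> permutes {1..n}" "\<forall>i. \<tau> (\<tau> i) = i" "\<forall>i. \<pi> (\<pi> i) = i"
    using assms by (auto simp: avoiding_involutions_iff)
  show ?thesis
    unfolding weight_def inversions_dsum[OF *(1)]
      cyc_involution[OF *(1,3)] cyc_involution[OF *(2,4)]
      cyc_involution[OF dsum_permutes[OF *] allI[OF dsum_involution[OF *]]] fp_dsum exc_dsum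
    by (simp add: power_add mult_ac)
qed

section \<open>Involutions avoiding 321 and 4123\<close>

abbreviation AI :: "nat \<Rightarrow> (nat \<Rightarrow> nat) set" where
  "AI n \<equiv> avoiding_involutions n {[3, 2, 1], [4, 1, 2, 3]}"

lemma contains_321_iff:
  "contains_pattern n \<pi> [3, 2, 1] \<longleftrightarrow>
     (\<exists>i j k. 1 \<le> i \<and> i < j \<and> j < k \<and> k \<le> n \<and> \<pi> k < \<pi> j \<and> \<pi> j < \<pi> i)"
proof
  assume "contains_pattern n \<pi> [3, 2, 1]"
  then obtain i j k where "sorted_wrt (<) [i, j, k]" "set [i, j, k] \<subseteq> {1..n}"
    "\<forall>a<3. \<forall>b<3. \<pi> ([i, j, k] ! a) < \<pi> ([i, j, k] ! b) \<longleftrightarrow> [3, 2, 1::nat] ! a < [3, 2, 1] ! b"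
    unfolding contains_pattern_def by (auto simp: length_Suc_conv)
  then show "\<exists>i j k. 1 \<le> i \<and> i < j \<and> j < k \<and> k \<le> n \<and> \<pi> k < \<pi> j \<and> \<pi> j < \<pi> i"
    by (intro exI[of _ i] exI[of _ j] exI[of _ k]) (auto simp: numeral_3_eq_3 All_less_Suc)
next
  assume "\<exists>i j k. 1 \<le> i \<and> i < j \<and> j < k \<and> k \<le> n \<and> \<pi> k < \<pi> j \<and> \<pi> j < \<pi> i"
  then obtain i j k where "1 \<le> i" "i < j" "j < k" "k \<le> n" "\<pi> k < \<pi> j" "\<pi> j < \<pi> i"
    by blast
  then show "contains_pattern n \<pi> [3, 2, 1]"
    unfolding contains_pattern_def by (intro exI[of _ "[i, j, k]"]) (auto simp: All_less_Suc)
qed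

lemma contains_4123_iff:
  "contains_pattern n \<pi> [4, 1, 2, 3] \<longleftrightarrow>
     (\<exists>i j k l. 1 \<le> i \<and> i < j \<and> j < k \<and> k < l \<and> l \<le> n \<and>
        \<pi> j < \<pi> k \<and> \<pi> k < \<pi> l \<and> \<pi> l < \<pi> i)"
proof
  assume "contains_pattern n \<pi> [4, 1, 2, 3]"
  then obtain i j k l where "sorted_wrt (<) [i, j, k, l]" "set [i, j, k, l] \<subseteq> {1..n}"
    "\<forall>a<4. \<forall>b<4. \<pi> ([i, j, k, l] ! a) < \<pi> ([i, j, k, l] ! b) \<longleftrightarrow>
       [4, 1, 2, 3::nat] ! a < [4, 1, 2, 3] ! b"
    unfolding contains_pattern_def by (auto simp: length_Suc_conv)
  then show "\<exists>i j k l. 1 \<le> i \<and> i < j \<and> j < k \<and> k < l \<and> l \<le> n \<and>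
        \<pi> j < \<pi> k \<and> \<pi> k < \<pi> l \<and> \<pi> l < \<pi> i"
    by (intro exI[of _ i] exI[of _ j] exI[of _ k] exI[of _ l])
      (auto simp: eval_nat_numeral All_less_Suc)
next
  assume "\<exists>i j k l. 1 \<le> i \<and> i < j \<and> j < k \<and> k < l \<and> l \<le> n \<and>
        \<pi> j < \<pi> k \<and> \<pi> k < \<pi> l \<and> \<pi> l < \<pi> i"
  then obtain i j k l where "1 \<le> i" "i < j" "j < k" "k < l" "l \<le> n"
      "\<pi> j < \<pi> k" "\<pi> k < \<pi> l" "\<pi> l < \<pi> i"
    by blast
  then show "contains_pattern n \<pi> [4, 1, 2, 3]"
    unfolding contains_pattern_def
    by (intro exI[of _ "[i, j, k, l]"]) (auto simp: All_less_Suc)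
qed

text \<open>The pattern conditions carry no upper bound on the indices: beyond \<open>n\<close> the
  permutation is the identity, and below it stays at most \<open>n\<close>, so the right end of any
  inversion is at most \<open>n\<close>.\<close>

lemma AI_D:
  assumes "\<pi> \<in> AI n"
  shows "\<pi> permutes {1..n}" "\<pi> (\<pi> i) = i"
    "\<lbrakk>1 \<le> i; i < j; j < k; \<pi> k < \<pi> j; \<pi> j < \<pi> i\<rbrakk> \<Longrightarrow> False"
    "\<lbrakk>1 \<le> i; i < j; j < k; k < l; \<pi> j < \<pi> k; \<pi> k < \<pi> l; \<pi> l < \<pi> i\<rbrakk> \<Longrightarrow> False"
proof -
  show perm: "\<pi> permutes {1..n}" and "\<pi> (\<pi> i) = i"
    using assms by (auto simp: avoiding_involutions_iff)
  have no: "\<not> contains_pattern n \<pi> [3, 2, 1]" "\<not> contains_pattern n \<pi> [4, 1, 2, 3]"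
    using assms by (auto simp: avoiding_involutions_iff)
  have bound: "k \<le> n" if "i < k" "\<pi> k < \<pi> i" for i k
    using that permutes_not_in[OF perm, of k] permutes_atLeast1_le[OF perm, of i]
      permutes_not_in[OF perm, of i]
    by (cases "k \<le> n"; cases "i \<le> n") auto
  show "\<lbrakk>1 \<le> i; i < j; j < k; \<pi> k < \<pi> j; \<pi> j < \<pi> i\<rbrakk> \<Longrightarrow> False"
    using no(1) bound[of j k] unfolding contains_321_iff by blast
  show "\<lbrakk>1 \<le> i; i < j; j < k; k < l; \<pi> j < \<pi> k; \<pi> k < \<pi> l; \<pi> l < \<pi> i\<rbrakk> \<Longrightarrow> False"
    using no(2) bound[of i l] unfolding contains_4123_iff by (meson less_trans)
qed

text \<open>In an involution the value \<open>a\<close> sits at position \<open>\<pi> a\<close>.\<close>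

lemma AI_increasing:
  assumes "\<pi> \<in> AI n" "1 \<le> i" "i < \<pi> a" "i < \<pi> b" "a < b" "b < \<pi> i"
  shows "\<pi> a < \<pi> b"
proof (rule ccontr)
  assume "\<not> \<pi> a < \<pi> b"
  moreover have "\<pi> a \<noteq> \<pi> b" using AI_D(2)[OF assms(1)] assms(5) by (metis less_irrefl)
  ultimately have "\<pi> b < \<pi> a" by simp
  \<comment> \<open>Positions \<open>i\<close>, \<open>\<pi> b\<close>, \<open>\<pi> a\<close> would
    increase while carrying the decreasing values \<open>\<pi> i\<close>, \<open>b\<close>,
    \<open>a\<close>.\<close>
  then show False
    using AI_D(3)[OF assms(1,2), of "\<pi> b" "\<pi> a"] assms AI_D(2)[OF assms(1)] by simp
qed

text \<open>By \<open>AI_increasing\<close> the values \<open>a\<close>, \<open>b\<close>,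
  \<open>c\<close> occur in this order to the right of \<open>i\<close>, so that
  \<open>\<pi> i\<close>, \<open>a\<close>, \<open>b\<close>, \<open>c\<close> forms 4123. Stating
  the condition through values avoids speaking of their positions.\<close>

lemma AI_no_4123:
  assumes "\<pi> \<in> AI n" "1 \<le> i" "i < \<pi> a" "i < \<pi> b" "i < \<pi> c" "a < b" "b < c" "c < \<pi> i"
  shows False
proof -
  have "\<pi> a < \<pi> b" "\<pi> b < \<pi> c"
    using AI_increasing[OF assms(1,2), of a b] AI_increasing[OF assms(1,2), of b c] assms by auto
  then show False
    using AI_D(4)[OF assms(1,2,3), of "\<pi> b" "\<pi> c"] assms AI_D(2)[OF assms(1)] by simp
qed

definition block3412 :: "nat \<Rightarrow> nat" where
  "block3412 = id(1 := 3, 2 := 4, 3 := 1, 4 := 2)"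

definition block21 :: "nat \<Rightarrow> nat" where
  "block21 = id(1 := 2, 2 := 1)"

lemma AI_first_block:
  assumes \<pi>: "\<pi> \<in> AI n"
  shows "\<pi> 1 = 1 \<or> (\<pi> 1 = 2 \<and> \<pi> 2 = 1) \<or> (\<pi> 1 = 3 \<and> \<pi> 2 = 4 \<and> \<pi> 3 = 1 \<and> \<pi> 4 = 2)"
proof -
  note inv = AI_D(2)[OF \<pi>] and perm = AI_D(1)[OF \<pi>]
  have inj: "\<pi> a \<noteq> \<pi> b" if "a \<noteq> b" for a b using inv that by metis
  have pos: "1 \<le> \<pi> i" if "1 \<le> i" for i using permutes_atLeast1_ge[OF perm that] .
  have "\<pi> 1 \<le> 3"
  proof (rule ccontr)
    assume *: "\<not> \<pi> 1 \<le> 3"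
    \<comment> \<open>The value 1 sits at position \<open>\<pi> 1\<close>, which is at least
      4.\<close>
    have "1 < \<pi> i" if "i \<in> {1, 2, 3}" for i
    proof -
      have "\<pi> i \<noteq> 1" using * that inv[of i] by auto
      then show ?thesis using pos[of i] that by auto
    qed
    then show False using AI_no_4123[OF \<pi>, of 1 1 2 3] * by simp
  qed
  moreover have "\<pi> 2 = 4" if 3: "\<pi> 1 = 3"
  proof (rule ccontr)
    assume *: "\<pi> 2 \<noteq> 4"
    have \<pi>3: "\<pi> 3 = 1" using inv[of 1] 3 by simp
    \<comment> \<open>The values 1 and 3 are taken at positions 3 and 1, and
      \<open>\<pi> 2 = 2\<close> would give 321 on the first three positions; this leaves only
      values above 4.\<close>
    have "\<pi> 2 \<noteq> 1" "\<pi> 2 \<noteq> 3" using inj[of 2 3] inj[of 2 1] 3 \<pi>3 by auto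
    moreover have "\<pi> 2 \<noteq> 2"
    proof
      assume "\<pi> 2 = 2"
      then show False using AI_D(3)[OF \<pi>, of 1 2 3] 3 \<pi>3 by simp
    qed
    ultimately have 2: "4 < \<pi> 2" using pos[of 2] * by linarith
    \<comment> \<open>The value 1 is at position 3, and \<open>\<pi> 4 = 2\<close> would force
      \<open>\<pi> 2 = 4\<close>. So the value 4 lies to the right of position 2, as do 1 and
      2.\<close>
    moreover have "2 < \<pi> 4"
      using inj[of 4 3] \<pi>3 pos[of 4] inv[of 4] 2 by (cases "\<pi> 4 = 2") auto
    ultimately show False using AI_no_4123[OF \<pi>, of 2 1 2 4] 3 by simp
  qed
  \<comment> \<open>The images of 1 and 2 determine the rest of the block, since
    \<open>\<pi>\<close> is an involution.\<close>
  ultimately show ?thesis using pos[of 1] inv[of 1] inv[of 2]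
    by (metis One_nat_def Suc_1 le_Suc_eq le_antisym numeral_3_eq_3 order_refl)
qed

section \<open>The three blocks and their weights\<close>

lemma atLeastAtMost_4: "{1..4} = {1, 2, 3, 4::nat}" and atLeastAtMost_2: "{1..2} = {1, 2::nat}"
  by auto

lemma id_AI: "id \<in> AI n"
  unfolding avoiding_involutions_iff by (auto simp: permutes_id contains_321_iff contains_4123_iff simp del: One_nat_def)

lemma block21_AI: "block21 \<in> AI 2"
  unfolding avoiding_involutions_iff
  by (auto simp: contains_321_iff contains_4123_iff block21_def
      simp del: One_nat_def intro!: involution_permutes)

lemma block3412_AI: "block3412 \<in> AI 4"
proof -
  have inv: "block3412 (block3412 i) = i" for i by (simp add: block3412_def)
  have perm: "block3412 permutes {1..4}"
    by (rule involution_permutes) (auto simp: inv, auto simp: block3412_def)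
  have no3: False if "1 \<le> i" "i < j" "j < k" "k \<le> 4"
    "block3412 k < block3412 j" "block3412 j < block3412 i" for i j k
  proof -
    have "i \<in> {1..4}" "j \<in> {1..4}" "k \<in> {1..4}" using that by auto
    then show ?thesis unfolding atLeastAtMost_4 using that by (auto simp: block3412_def)
  qed
  \<comment> \<open>Four increasing indices in \<open>{1..4}\<close> must be 1, 2, 3, 4, and the
    entries at 2 and 3 are 4 and 1, a descent.\<close>
  have no4: False if "1 \<le> i" "i < j" "j < k" "k < l" "l \<le> 4"
    "block3412 j < block3412 k" for i j k l
  proof -
    have "j = 2" "k = 3" using that by auto
    then show ?thesis using that by (simp add: block3412_def)
  qed
  show ?thesis
    unfolding avoiding_involutions_iff using inv perm no3
    by (auto simp: contains_321_iff contains_4123_iff simp del: One_nat_def) (use no4 in blast)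
qed

lemma weight_id_1: "weight 1 id = var_t * var_u"
proof -
  have "{(i, j). i \<in> {1..1} \<and> j \<in> {1..1} \<and> i < j \<and> id i > (id j :: nat)} = {}" by auto
  then have "inversions 1 id = 0" unfolding inversions_def by (simp only: card.empty)
  moreover have "fp 1 id = 1" "exc 1 id = 0" by (simp_all add: fp_def exc_def)
  ultimately show ?thesis using cyc_involution[of id 1] by (simp add: weight_def permutes_id)
qed

lemma weight_block21: "weight 2 block21 = var_t * var_x * var_y"
proof -
  have "{i \<in> {1..2}. block21 i = i} = {}" "{i \<in> {1..2}. block21 i > i} = {1}"
    "{(i, j). i \<in> {1..2} \<and> j \<in> {1..2} \<and> i < j \<and> block21 i > block21 j} = {(1, 2)}"
    unfolding atLeastAtMost_2 by (auto simp: block21_def)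
  then have "fp 2 block21 = 0" "exc 2 block21 = 1" "inversions 2 block21 = 1"
    unfolding fp_def exc_def inversions_def by simp_all
  then show ?thesis using cyc_involution[of block21 2] block21_AI
    by (simp add: weight_def avoiding_involutions_iff)
qed

lemma weight_block3412: "weight 4 block3412 = var_t ^ 2 * var_x ^ 2 * var_y ^ 4"
proof -
  have "{i \<in> {1..4}. block3412 i = i} = {}" "{i \<in> {1..4}. block3412 i > i} = {1, 2}"
    "{(i, j). i \<in> {1..4} \<and> j \<in> {1..4} \<and> i < j \<and> block3412 i > block3412 j} =
       {(1, 3), (1, 4), (2, 3), (2, 4)}"
    unfolding atLeastAtMost_4 by (auto simp: block3412_def split: if_splits)
  then have "fp 4 block3412 = 0" "exc 4 block3412 = 2" "inversions 4 block3412 = 4"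
    unfolding fp_def exc_def inversions_def by simp_all
  then show ?thesis using cyc_involution[of block3412 4] block3412_AI
    by (simp add: weight_def avoiding_involutions_iff numeral_2_eq_2)
qed

section \<open>The generating function\<close>

text \<open>For positive \<open>n\<close> this is the coefficient of \<open>H\<close> at
  \<open>n\<close> (see \<open>Sum_any_h\<close>); at \<open>n = 0\<close> the empty permutation is
  counted as well, which lets the recurrence start.\<close>

definition AI_poly :: "nat \<Rightarrow> tuxy_poly" where
  "AI_poly n = (\<Sum>\<pi>\<in>AI n. weight n \<pi>)"

lemma finite_AI: "finite (AI n)"
  by (rule finite_subset[OF _ finite_permutations[of "{1..n}"]])
    (auto simp: avoiding_involutions_iff)

text \<open>Prescribing the first block means summing over \<open>dsum b \<tau> \<pi>\<close> with
  \<open>\<pi>\<close> in \<open>AI (n - b)\<close>, and weights multiply. If \<open>n < b\<close>,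
  every member of \<open>AI n\<close> fixes \<open>b\<close>; the second hypothesis then says that
  \<open>\<tau>\<close> moves \<open>b\<close>, so the sum is empty.\<close>

lemma sum_weight_block:
  assumes \<tau>: "\<tau> \<in> AI b" and "\<tau> b \<noteq> b \<or> b \<le> n"
  shows "(\<Sum>\<pi> | \<pi> \<in> AI n \<and> (\<forall>i\<in>{1..b}. \<pi> i = \<tau> i). weight n \<pi>) =
           (if n < b then 0 else weight b \<tau> * AI_poly (n - b))"
proof (cases "n < b")
  case True
  have False if "\<pi> \<in> AI n" "\<forall>i\<in>{1..b}. \<pi> i = \<tau> i" for \<pi>
  proof -
    have "\<pi> b = b" using permutes_not_in[OF AI_D(1)[OF that(1)], of b] True by simp
    then show False using that(2) assms(2) True by (cases "b = 0") auto
  qed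
  then have "{\<pi>. \<pi> \<in> AI n \<and> (\<forall>i\<in>{1..b}. \<pi> i = \<tau> i)} = {}" by blast
  then show ?thesis using True by (simp only: sum.empty if_True)
next
  case False
  then obtain m where n: "n = b + m" by (metis le_add_diff_inverse not_less)
  \<comment> \<open>Both patterns begin with their maximum, as \<open>contains_pattern_dsum\<close>
    requires.\<close>
  have \<Sigma>: "\<sigma> \<noteq> [] \<and> (\<forall>a<length \<sigma>. 0 < a \<longrightarrow> \<sigma> ! a < \<sigma> ! 0)"
    if "\<sigma> \<in> {[3, 2, 1], [4, 1, 2, 3::nat]}" for \<sigma>
    using that by (auto simp: less_Suc_eq)
  have perm: "\<tau> permutes {1..b}" using AI_D(1)[OF \<tau>] .
  have "{\<pi>. \<pi> \<in> AI n \<and> (\<forall>i\<in>{1..b}. \<pi> i = \<tau> i)} = dsum b \<tau> ` AI m"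
  proof (intro equalityI subsetI)
    fix \<rho> assume "\<rho> \<in> {\<pi>. \<pi> \<in> AI n \<and> (\<forall>i\<in>{1..b}. \<pi> i = \<tau> i)}"
    then have "\<rho> \<in> AI (b + m)" "\<forall>i\<in>{1..b}. \<rho> i = \<tau> i" by (auto simp: n)
    from avoiding_involution_split[OF this(1) perm this(2) \<Sigma>]
    show "\<rho> \<in> dsum b \<tau> ` AI m" by blast
  next
    fix \<rho> assume "\<rho> \<in> dsum b \<tau> ` AI m"
    then obtain \<pi> where "\<pi> \<in> AI m" "\<rho> = dsum b \<tau> \<pi>" by blast
    then show "\<rho> \<in> {\<pi>. \<pi> \<in> AI n \<and> (\<forall>i\<in>{1..b}. \<pi> i = \<tau> i)}"
      using dsum_in_avoiding_involutions[OF \<tau> _ \<Sigma>] by (auto simp: n)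
  qed
  moreover have "inj_on (dsum b \<tau>) (AI m)"
    by (rule inj_on_subset[OF inj_on_dsum[of b \<tau> m]]) (auto simp: avoiding_involutions_iff)
  ultimately have "(\<Sum>\<pi> | \<pi> \<in> AI n \<and> (\<forall>i\<in>{1..b}. \<pi> i = \<tau> i). weight n \<pi>) =
      (\<Sum>\<pi>\<in>AI m. weight (b + m) (dsum b \<tau> \<pi>))"
    by (simp only: sum.reindex o_def n)
  also have "\<dots> = weight b \<tau> * AI_poly m"
    using weight_dsum[OF \<tau>] by (simp add: AI_poly_def sum_distrib_left)
  finally show ?thesis by (simp add: n)
qed

lemma AI_poly_recurrence:
  assumes "n \<ge> 1"
  shows "AI_poly n = var_t * var_u * AI_poly (n - 1)
     + (if n < 2 then 0 else var_t * var_x * var_y * AI_poly (n - 2))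
     + (if n < 4 then 0 else var_t ^ 2 * var_x ^ 2 * var_y ^ 4 * AI_poly (n - 4))"
proof -
  define B where "B b \<tau> = {\<pi>. \<pi> \<in> AI n \<and> (\<forall>i\<in>{1..b}. \<pi> i = \<tau> i)}"
    for b :: nat and \<tau> :: "nat \<Rightarrow> nat"
  have B1: "B 1 id = {\<pi> \<in> AI n. \<pi> 1 = 1}"
    and B2: "B 2 block21 = {\<pi> \<in> AI n. \<pi> 1 = 2 \<and> \<pi> 2 = 1}"
    and B4: "B 4 block3412 = {\<pi> \<in> AI n. \<pi> 1 = 3 \<and> \<pi> 2 = 4 \<and> \<pi> 3 = 1 \<and> \<pi> 4 = 2}"
    unfolding B_def atLeastAtMost_2 atLeastAtMost_4 by (auto simp: block21_def block3412_def)
  have fin: "finite (B b \<tau>)" for b \<tau> using finite_AI[of n] by (simp add: B_def)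
  have AI: "AI n = B 1 id \<union> B 2 block21 \<union> B 4 block3412"
    using AI_first_block unfolding B1 B2 B4 by blast
  have "AI_poly n = (\<Sum>\<pi>\<in>B 1 id. weight n \<pi>) + (\<Sum>\<pi>\<in>B 2 block21. weight n \<pi>)
      + (\<Sum>\<pi>\<in>B 4 block3412. weight n \<pi>)"
  proof -
    \<comment> \<open>The value at 1, namely 1, 2 or 3, separates the three classes.\<close>
    have "B 1 id \<inter> B 2 block21 = {}" "(B 1 id \<union> B 2 block21) \<inter> B 4 block3412 = {}"
      unfolding B1 B2 B4 by auto
    then show ?thesis by (simp only: AI_poly_def AI sum.union_disjoint fin finite_UnI)
  qed
  also have "\<dots> = (if n < 1 then 0 else weight 1 id * AI_poly (n - 1))
      + (if n < 2 then 0 else weight 2 block21 * AI_poly (n - 2))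
      + (if n < 4 then 0 else weight 4 block3412 * AI_poly (n - 4))"
    \<comment> \<open>The side condition of \<open>sum_weight_block\<close> holds because
      \<open>block21\<close> and \<open>block3412\<close> move their last point, and for
      \<open>id\<close> because \<open>n\<close> is at least 1.\<close>
    unfolding B_def using assms
    by (intro arg_cong2[where f = "(+)"] sum_weight_block id_AI block21_AI block3412_AI)
      (auto simp: block21_def block3412_def)
  finally show ?thesis
    using assms by (simp only: weight_id_1 weight_block21 weight_block3412) simp
qed

lemma AI_poly_0: "AI_poly 0 = 1"
proof -
  have "AI 0 = {id}" using id_AI[of 0] by (auto simp: avoiding_involutions_iff)
  then show ?thesis
    by (simp add: AI_poly_def weight_def cyc_def fp_def exc_def inversions_def)
qed

text \<open>Each involution contributes its monomial to exactly one quadruple of exponents, so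
  collecting by the fibres of the statistics turns the weighted counts into a sum over
  \<open>AI n\<close>.\<close>

lemma Sum_any_h:
  "Sum_any (\<lambda>(k, l, m, j). of_nat (h n k l m j) * var_t ^ k * var_u ^ m * var_x ^ l * var_y ^ j)
     = AI_poly n"
proof -
  \<comment> \<open>The order follows the arguments of \<open>h\<close>, with \<open>exc\<close>
    before \<open>fp\<close>, whereas the monomial lists the power of \<open>var_u\<close> before
    that of \<open>var_x\<close>.\<close>
  define s where "s \<pi> = (cyc n \<pi>, exc n \<pi>, fp n \<pi>, inversions n \<pi>)" for \<pi>
  define v :: "nat \<times> nat \<times> nat \<times> nat \<Rightarrow> tuxy_poly" where
    "v = (\<lambda>(k, l, m, j). var_t ^ k * var_u ^ m * var_x ^ l * var_y ^ j)"
  have h: "h n k l m j = card {\<pi> \<in> AI n. s \<pi> = (k, l, m, j)}" for k l m j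
    unfolding h_def s_def by (intro arg_cong[where f = card]) auto
  have "Sum_any (\<lambda>(k, l, m, j).
          of_nat (h n k l m j) * var_t ^ k * var_u ^ m * var_x ^ l * var_y ^ j)
      = Sum_any (\<lambda>q. of_nat (card {\<pi> \<in> AI n. s \<pi> = q}) * v q)"
    by (intro arg_cong[where f = Sum_any] ext) (auto simp: h v_def mult_ac)
  also have "\<dots> = (\<Sum>q\<in>s ` AI n. of_nat (card {\<pi> \<in> AI n. s \<pi> = q}) * v q)"
  \<comment> \<open>Quadruples that no involution attains have count zero, so the finite image of
    \<open>s\<close> contains the support.\<close>
  proof (rule Sum_any.expand_superset)
    show "finite (s ` AI n)" using finite_AI by simp
    have no: "card {\<pi> \<in> AI n. s \<pi> = q} = 0" if "q \<notin> s ` AI n" for q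
      using that by (auto simp: card_eq_0_iff)
    show "{q. of_nat (card {\<pi> \<in> AI n. s \<pi> = q}) * v q \<noteq> 0} \<subseteq> s ` AI n"
      by (intro subsetI, rule ccontr) (simp add: no del: One_nat_def)
  qed
  \<comment> \<open>On the fibre over \<open>q\<close> the summand is constantly \<open>v q\<close>,
    whence the factor \<open>card\<close>.\<close>
  also have "\<dots> = (\<Sum>q\<in>s ` AI n. \<Sum>\<pi> | \<pi> \<in> AI n \<and> s \<pi> = q. v (s \<pi>))"
    by (intro sum.cong) auto
  also have "\<dots> = (\<Sum>\<pi>\<in>AI n. v (s \<pi>))"
    by (rule sum.image_gen[OF finite_AI, symmetric])
  also have "\<dots> = AI_poly n" by (simp add: AI_poly_def weight_def v_def s_def)
  finally show ?thesis .
qed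

text \<open>The case distinction has the shape of those in \<open>AI_poly_recurrence\<close>, so the
  coefficients can be compared term by term.\<close>

lemma fps_const_mult_X_power_nth:
  "fps_nth (fps_const c * fps_X ^ k * F) n = (if n < k then 0 else c * fps_nth F (n - k))"
  by (simp add: mult.assoc fps_X_power_mult_nth)

text \<open>The quotient is formed in the field of fractions of the power series ring, into which
  \<open>to_fract\<close> embeds.\<close>

theorem theorem21:
  fixes t u x y z :: "tuxy_poly fps"
  defines "t \<equiv> fps_const var_t" and "u \<equiv> fps_const var_u"
    and "x \<equiv> fps_const var_x" and "y \<equiv> fps_const var_y" and "z \<equiv> fps_X"
  shows "to_fract H =
    to_fract (t * u * z + t * x * y * z ^ 2 + t ^ 2 * x ^ 2 * y ^ 4 * z ^ 4) /
    to_fract (1 - t * u * z - t * x * y * z ^ 2 - t ^ 2 * x ^ 2 * y ^ 4 * z ^ 4)"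
proof -
  define Q where "Q = t * u * z + t * x * y * z ^ 2 + t ^ 2 * x ^ 2 * y ^ 4 * z ^ 4"
  define F where "F = Abs_fps AI_poly"
  have Q: "Q = fps_const (var_t * var_u) * fps_X ^ 1 + fps_const (var_t * var_x * var_y) * fps_X ^ 2
      + fps_const (var_t ^ 2 * var_x ^ 2 * var_y ^ 4) * fps_X ^ 4"
    unfolding Q_def t_def u_def x_def y_def z_def by (simp add: fps_const_power)
  have H: "H = F - 1"
    by (rule fps_ext) (auto simp: H_def F_def Sum_any_h AI_poly_0 not_le)
  \<comment> \<open>This is \<open>AI_poly_recurrence\<close> as a functional equation; the summand
    1 accounts for \<open>n = 0\<close>, where \<open>Q * F\<close> has coefficient 0.\<close>
  have "F = 1 + Q * F"
  proof (rule fps_ext)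
    fix n show "fps_nth F n = fps_nth (1 + Q * F) n"
    proof (cases "n = 0")
      case True
      then show ?thesis
        unfolding Q distrib_right fps_add_nth fps_const_mult_X_power_nth by (simp add: F_def AI_poly_0)
    next
      case False
      then show ?thesis
        unfolding Q distrib_right fps_add_nth fps_const_mult_X_power_nth
        using AI_poly_recurrence[of n] by (simp add: F_def)
    qed
  qed
  then have HQ: "H * (1 - Q) = Q" by (simp add: H algebra_simps)
  \<comment> \<open>\<open>Q\<close> has no constant term, so the denominator is nonzero and
    \<open>HQ\<close> may be divided by it.\<close>
  have "fps_nth (1 - Q) 0 = 1" unfolding Q by simp
  then have "1 - Q \<noteq> 0" by (metis fps_zero_nth zero_neq_one)
  then have "to_fract H = to_fract Q / to_fract (1 - Q)"
    by (metis HQ nonzero_eq_divide_eq to_fract_eq_0_iff to_fract_mult)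
  moreover have "1 - Q = 1 - t * u * z - t * x * y * z ^ 2 - t ^ 2 * x ^ 2 * y ^ 4 * z ^ 4"
    by (simp add: Q_def algebra_simps)
  ultimately show ?thesis unfolding Q_def by simp
qed

end
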